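(* Let $G=(V,E,\mathcal{P},(V_\Diamond,V_\square))$ be a parity game on which the small progress measures lifting procedure is run with an arbitrary lifting sequence: starting from $\rho=\lambda v.(0,\dots,0)$, repeatedly $\rho$ is replaced by $\mathrm{Lift}(\rho,v)$ for some $v$ with $\rho\sqsubset\mathrm{Lift}(\rho,v)$. Suppose that at some point a vertex $v$ with $\mathcal{P}(v)=k$ is the first vertex whose measure becomes $\top$, and let $\rho$ be the measure at that point. Then: (1) if $v\in V_\square$, then for every successor $u$ of $v$ whose measure $\rho(u)$ is maximal among $\{\rho(w)\mid w\in v^\bullet\}$ there is a $\square$-dominion $D_u$ containing $\mathrm{Attr}^{\geq k}_\square(\{v\})$ such that $\mathcal{P}(w)\geq k$ for all $w\in D_u$; moreover, $\square$ has a winning strategy $\sigma$ that is closed on $D_u$, with $\sigma(v)=u$ and with $\sigma$ on $\mathrm{Attr}^{\geq k}_\square(\{v\})\setminus\{v\}$ being the strategy attracting towards $v$; (2) if $v\in V_\Diamond$, then there is a $\square$-dominion $D$ containing $\mathrm{Attr}^{\geq k}_\square(\{v\})$ such that $\mathcal{P}(w)\geq k$ for all $w\in D$; moreover, $\square$ has a winning strategy $\sigma$ that is closed on $D$ and that on $\mathrm{Attr}^{\geq k}_\square(\{v\})\setminus\{v\}$ is the strategy attracting towards $v$ (in this case $v^\bullet\subseteq D$).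
   Context: A parity game $G=(V,E,\mathcal{P},(V_\Diamond,V_\square))$ consists of a finite set $V$ of vertices partitioned into $V_\Diamond$ (owned by player even, $\Diamond$) and $V_\square$ (owned by player odd, $\square$), a total edge relation $E\subseteq V\times V$, and a priority function $\mathcal{P}:V\to\mathbb{N}$. Write $v^\bullet=\{w\mid (v,w)\in E\}$, $V_i=\{v\mid\mathcal{P}(v)=i\}$, $V_{\geq k}=\{v\mid\mathcal{P}(v)\geq k\}$. In a play, $\Diamond$ wins iff the least priority occurring infinitely often is even. A set $U$ is a $\square$-dominion if $\square$ has a strategy such that every play starting in $U$ consistent with it stays in $U$ and is won by $\square$; a strategy is closed on $U$ if plays from $U$ consistent with it stay in $U$. Measures: let $d$ be one more than the largest priority. Tuples in $\mathbb{N}^d$ (positions $0,\dots,d-1$) are ordered lexicographically; $\alpha<_i\beta$ compares only positions $0,\dots,i$ lexicographically. $\mathbb{M}^\Diamond$ consists of $\top$ and all tuples with $0$ at even positions and a value $\le|V_i|$ at each odd position $i$; every tuple is $<\top$ (also for $<_i$). For $\rho:V\to\mathbb{M}^\Diamond$ and $w\in v^\bullet$, $\mathrm{Prog}(\rho,v,w)$ is the least $m\in\mathbb{M}^\Diamond$ with $m\geq_{\mathcal{P}(v)}\rho(w)$ if $\mathcal{P}(v)$ is even, and with $m>_{\mathcal{P}(v)}\rho(w)$ or $m=\rho(w)=\top$ if $\mathcal{P}(v)$ is odd. $\mathrm{Lift}(\rho,v)$ is $\rho$ with $\rho(v)$ replaced by $\max\{\rho(v),\min\{\mathrm{Prog}(\rho,v,w)\mid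 w\in v^\bullet\}\}$ if $v\in V_\Diamond$, and by $\max\{\rho(v),\max\{\mathrm{Prog}(\rho,v,w)\mid w\in v^\bullet\}\}$ if $v\in V_\square$. $\rho\sqsubseteq\rho'$ is the pointwise order and $\rho\sqsubset\rho'$ means $\rho\sqsubseteq\rho'$ and $\rho\neq\rho'$. Guarded attractor: for a priority $k$ and $U\subseteq W\cap V_{\geq k}$, $\mathrm{Attr}^{\geq k}_{\square,W}(U)$ is the least set $A$ with $U\subseteq A\subseteq W\cap V_{\geq k}$ such that (a) every $u\in V_\square$ (in $W\cap V_{\geq k}$) with $u^\bullet\cap A\neq\emptyset$ is in $A$, and (b) every $u\in V_\Diamond$ (in $W\cap V_{\geq k}$) with $u^\bullet\cap W\subseteq A$ is in $A$. $\mathrm{Attr}^{\geq k}_\square(U)$ denotes the case $W=V$. The strategy attracting towards $v$ is the positional strategy of $\square$ on this attractor that forces every play into $\{v\}$ (within the attractor). *)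

theory Defs
  imports Main "HOL-Library.Infinite_Set" "HOL-Library.List_Lexorder"
begin

record 'v game =
  verts :: "'v set"
  edges :: "('v \<times> 'v) set"
  prio :: "'v \<Rightarrow> nat"
  even_verts :: "'v set"
  odd_verts :: "'v set"

locale parity_game =
  fixes G :: "'v game"
  assumes finite_verts: "finite (verts G)"
    and owners_cover: "even_verts G \<union> odd_verts G = verts G"
    and owners_disjoint: "even_verts G \<inter> odd_verts G = {}"
    and edges_within: "edges G \<subseteq> verts G \<times> verts G"
    and edges_total: "\<And>v. v \<in> verts G \<Longrightarrow> \<exists>w. (v, w) \<in> edges G"

definition succs :: "'v game \<Rightarrow> 'v \<Rightarrow> 'v set" where
  "succs G v = {w. (v, w) \<in> edges G}"

definition prio_eq :: "'v game \<Rightarrow> nat \<Rightarrow> 'v set" where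
  "prio_eq G i = {v \<in> verts G. prio G v = i}"

definition prio_ge :: "'v game \<Rightarrow> nat \<Rightarrow> 'v set" where
  "prio_ge G k = {v \<in> verts G. prio G v \<ge> k}"

definition play :: "'v game \<Rightarrow> (nat \<Rightarrow> 'v) \<Rightarrow> bool" where
  "play G \<pi> \<longleftrightarrow> \<pi> 0 \<in> verts G \<and> (\<forall>i. (\<pi> i, \<pi> (Suc i)) \<in> edges G)"

definition even_wins :: "'v game \<Rightarrow> (nat \<Rightarrow> 'v) \<Rightarrow> bool" where
  "even_wins G \<pi> \<longleftrightarrow> even (LEAST p. \<exists>\<^sub>\<infinity>i. prio G (\<pi> i) = p)"

text \<open>
  A strategy of player odd maps the history, a list whose last element is the current vertex,
  to the next vertex. Strategies are total on histories ending in a vertex of player odd; as the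
  edge relation is total, every partial strategy extends to such a strategy.
\<close>

definition odd_strategy :: "'v game \<Rightarrow> ('v list \<Rightarrow> 'v) \<Rightarrow> bool" where
  "odd_strategy G \<sigma> \<longleftrightarrow> (\<forall>h. \<forall>x\<in>odd_verts G. \<sigma> (h @ [x]) \<in> succs G x)"

definition positional :: "('v \<Rightarrow> 'v) \<Rightarrow> 'v list \<Rightarrow> 'v" where
  "positional f = (\<lambda>h. f (last h))"

definition consistent :: "'v game \<Rightarrow> ('v list \<Rightarrow> 'v) \<Rightarrow> (nat \<Rightarrow> 'v) \<Rightarrow> bool" where
  "consistent G \<sigma> \<pi> \<longleftrightarrow>
    (\<forall>i. \<pi> i \<in> odd_verts G \<longrightarrow> \<pi> (Suc i) = \<sigma> (map \<pi> [0..<Suc i]))"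

definition closed_on :: "'v game \<Rightarrow> ('v list \<Rightarrow> 'v) \<Rightarrow> 'v set \<Rightarrow> bool" where
  "closed_on G \<sigma> U \<longleftrightarrow>
    (\<forall>\<pi>. play G \<pi> \<and> consistent G \<sigma> \<pi> \<and> \<pi> 0 \<in> U \<longrightarrow> (\<forall>i. \<pi> i \<in> U))"

definition odd_winning_on :: "'v game \<Rightarrow> ('v list \<Rightarrow> 'v) \<Rightarrow> 'v set \<Rightarrow> bool" where
  "odd_winning_on G \<sigma> U \<longleftrightarrow>
    (\<forall>\<pi>. play G \<pi> \<and> consistent G \<sigma> \<pi> \<and> \<pi> 0 \<in> U \<longrightarrow> \<not> even_wins G \<pi>)"

definition odd_dominion :: "'v game \<Rightarrow> 'v set \<Rightarrow> bool" where
  "odd_dominion G U \<longleftrightarrow> U \<subseteq> verts G \<and>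
    (\<exists>\<sigma>. odd_strategy G \<sigma> \<and> closed_on G \<sigma> U \<and> odd_winning_on G \<sigma> U)"

text \<open>The set \<open>U\<close> is meant to satisfy \<open>U \<subseteq> W \<inter> prio_ge G k\<close>.\<close>

inductive_set attr :: "'v game \<Rightarrow> nat \<Rightarrow> 'v set \<Rightarrow> 'v set \<Rightarrow> 'v set"
  for G :: "'v game" and k :: nat and W U :: "'v set" where
  base: "u \<in> U \<Longrightarrow> u \<in> attr G k W U"
| odd_step: "u \<in> W \<inter> prio_ge G k \<Longrightarrow> u \<in> odd_verts G \<Longrightarrow> w \<in> succs G u \<Longrightarrow>
    w \<in> attr G k W U \<Longrightarrow> u \<in> attr G k W U"
| even_step: "u \<in> W \<inter> prio_ge G k \<Longrightarrow> u \<in> even_verts G \<Longrightarrow>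
    (\<And>w. w \<in> succs G u \<inter> W \<Longrightarrow> w \<in> attr G k W U) \<Longrightarrow> u \<in> attr G k W U"

text \<open>
  Every play from \<open>A\<close> consistent with \<open>\<sigma>\<close> reaches \<open>T\<close>, staying in \<open>A\<close> until it does. For a
  strategy \<open>positional f\<close> this depends only on the values of \<open>f\<close> on \<open>A - T\<close>, since strategies
  are total and so every finite consistent path extends to a consistent play.
\<close>

definition attracting :: "'v game \<Rightarrow> ('v list \<Rightarrow> 'v) \<Rightarrow> 'v set \<Rightarrow> 'v set \<Rightarrow> bool" where
  "attracting G \<sigma> A T \<longleftrightarrow> odd_strategy G \<sigma> \<and>
    (\<forall>\<pi>. play G \<pi> \<and> consistent G \<sigma> \<pi> \<and> \<pi> 0 \<in> A \<longrightarrow>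
      (\<exists>n. \<pi> n \<in> T \<and> (\<forall>i\<le>n. \<pi> i \<in> A)))"

text \<open>Lists are ordered lexicographically; all lists used below have the same length.\<close>

datatype pm = Tup "nat list" | Top

instantiation pm :: linorder
begin

fun less_eq_pm :: "pm \<Rightarrow> pm \<Rightarrow> bool" where
  "x \<le> Top \<longleftrightarrow> True"
| "Top \<le> Tup b \<longleftrightarrow> False"
| "Tup a \<le> Tup b \<longleftrightarrow> a \<le> b"

definition less_pm :: "pm \<Rightarrow> pm \<Rightarrow> bool" where
  "x < y \<longleftrightarrow> x \<le> y \<and> \<not> y \<le> (x :: pm)"

instance
proof
  fix x y z :: pm
  show "x < y \<longleftrightarrow> x \<le> y \<and> \<not> y \<le> x" by (rule less_pm_def)
  show "x \<le> x" by (cases x) auto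
  show "x \<le> y \<Longrightarrow> y \<le> z \<Longrightarrow> x \<le> z" by (cases x; cases y; cases z) auto
  show "x \<le> y \<Longrightarrow> y \<le> x \<Longrightarrow> x = y" by (cases x; cases y) auto
  show "x \<le> y \<or> y \<le> x" by (cases x; cases y) auto
qed

end

text \<open>
  Restriction to the positions \<open>0, \<dots>, i\<close>: the relation \<open>\<alpha> <\<^sub>i \<beta>\<close> is
  \<open>restr i \<alpha> < restr i \<beta>\<close>, and likewise for \<open>\<ge>\<^sub>i\<close>.
\<close>

fun restr :: "nat \<Rightarrow> pm \<Rightarrow> pm" where
  "restr i (Tup a) = Tup (take (Suc i) a)"
| "restr i Top = Top"

definition pm_dim :: "'v game \<Rightarrow> nat" where
  "pm_dim G = Suc (Max (prio G ` verts G))"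

definition pm_set :: "'v game \<Rightarrow> pm set" where
  "pm_set G = insert Top {Tup a | a. length a = pm_dim G \<and>
     (\<forall>i<pm_dim G. if even i then a ! i = 0 else a ! i \<le> card (prio_eq G i))}"

definition prog :: "'v game \<Rightarrow> ('v \<Rightarrow> pm) \<Rightarrow> 'v \<Rightarrow> 'v \<Rightarrow> pm" where
  "prog G \<rho> v w = (LEAST m. m \<in> pm_set G \<and>
     (if even (prio G v) then restr (prio G v) m \<ge> restr (prio G v) (\<rho> w)
      else restr (prio G v) m > restr (prio G v) (\<rho> w) \<or> (m = Top \<and> \<rho> w = Top)))"

definition lift :: "'v game \<Rightarrow> ('v \<Rightarrow> pm) \<Rightarrow> 'v \<Rightarrow> ('v \<Rightarrow> pm)" where
  "lift G \<rho> v = \<rho>(v := max (\<rho> v)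
     (if v \<in> even_verts G then Min (prog G \<rho> v ` succs G v)
      else Max (prog G \<rho> v ` succs G v)))"

definition init_pm :: "'v game \<Rightarrow> 'v \<Rightarrow> pm" where
  "init_pm G = (\<lambda>v. Tup (replicate (pm_dim G) 0))"

text \<open>
  The order on \<open>'v \<Rightarrow> pm\<close> is the pointwise one. Lifting does not change values outside
  \<open>verts G\<close>, so quantifying over the whole type makes no difference.
\<close>

definition lift_at :: "'v game \<Rightarrow> 'v \<Rightarrow> ('v \<Rightarrow> pm) \<Rightarrow> ('v \<Rightarrow> pm) \<Rightarrow> bool" where
  "lift_at G v \<rho> \<rho>' \<longleftrightarrow> v \<in> verts G \<and> \<rho>' = lift G \<rho> v \<and> \<rho> < \<rho>'"

definition lift_step :: "'v game \<Rightarrow> ('v \<Rightarrow> pm) \<Rightarrow> ('v \<Rightarrow> pm) \<Rightarrow> bool" where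
  "lift_step G \<rho> \<rho>' \<longleftrightarrow> (\<exists>v. lift_at G v \<rho> \<rho>')"

end

theory Submission
  imports Defs
begin

text \<open>
  Let \<open>A\<close> be the guarded attractor of \<open>v\<close>. Play the game on the vertices of priority at least
  \<open>k\<close> outside \<open>A\<close>, where odd wins on entering \<open>A\<close> and even wins on falling below priority \<open>k\<close>.
  It is positionally determined; let \<open>W0\<close> and \<open>W1\<close> be the regions of even and odd. On \<open>W0\<close> and
  below priority \<open>k\<close>, as long as no measure is \<open>Top\<close>, the measures never exceed a bound that is
  saturated at the positions below \<open>k\<close> and at position \<open>i \<ge> k\<close> counts the priority \<open>i\<close> vertices
  of \<open>W0\<close> that even's strategy can still visit without first seeing a smaller priority. Since
  \<open>v\<close> is not in \<open>W0\<close>, this bound is not saturated at \<open>k\<close>, whereas a successor whose measure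
  forces \<open>v\<close> to \<open>Top\<close> must be. So that successor lies in \<open>A \<union> W1\<close>, and on this set odd wins:
  either the play stays in \<open>W1\<close> eventually, or it returns to \<open>v\<close>, of odd priority \<open>k\<close>,
  infinitely often.
\<close>

section \<open>Positional determinacy of parity games with exits\<close>

text \<open>Keeping only priorities at least \<open>i\<close> makes a cycle through a vertex of
  priority \<open>i\<close> one whose least priority is \<open>i\<close>, so winning can be phrased
  by cycles instead of plays.\<close>

definition strat_edges ::
  "('v \<times> 'v) set \<Rightarrow> 'v set \<Rightarrow> ('v \<Rightarrow> nat) \<Rightarrow> ('v \<Rightarrow> 'v) \<Rightarrow> 'v set \<Rightarrow> nat \<Rightarrow> ('v \<times> 'v) set" where
  "strat_edges E P pr s W i = {(x, y) \<in> E. x \<in> W \<and> y \<in> W \<and> (x \<in> P \<longrightarrow> y = s x) \<and> i \<le> pr x \<and> i \<le> pr y}"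

text \<open>Moving to \<open>X\<close> counts as a win, so \<open>s\<close> is winning iff no cycle it allows is dominated by the
  wrong parity.\<close>

definition wins_region ::
  "('v \<times> 'v) set \<Rightarrow> 'v set \<Rightarrow> ('v \<Rightarrow> nat) \<Rightarrow> bool \<Rightarrow> 'v set \<Rightarrow> 'v set \<Rightarrow> ('v \<Rightarrow> 'v) \<Rightarrow> bool" where
  "wins_region E P pr b X W s \<longleftrightarrow>
     (\<forall>w\<in>W \<inter> P. (w, s w) \<in> E \<and> s w \<in> W \<union> X) \<and>
     (\<forall>w\<in>W - P. E `` {w} \<subseteq> W \<union> X) \<and>
     (\<forall>y. even (pr y) \<noteq> b \<longrightarrow> (y, y) \<notin> (strat_edges E P pr s W (pr y))\<^sup>+)"

lemma wins_region_empty: "wins_region E P pr b X {} s"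
proof -
  have "strat_edges E P pr s {} i = {}" for i
    by (auto simp: strat_edges_def)
  then show ?thesis by (simp add: wins_region_def)
qed

lemma trancl_closed_source:
  assumes "(x, y) \<in> r\<^sup>+" "x \<in> Z" "\<And>a b. (a, b) \<in> r \<Longrightarrow> a \<in> Z \<Longrightarrow> b \<in> Z"
  shows "y \<in> Z \<and> (x, y) \<in> (r \<inter> Z \<times> Z)\<^sup>+"
  using assms(1)
proof induction
  case (base y)
  then show ?case using assms(2,3) by blast
next
  case (step y z)
  then have "z \<in> Z" using assms(3) by blast
  then have "(y, z) \<in> r \<inter> Z \<times> Z" using step by blast
  with step \<open>z \<in> Z\<close> show ?case by (meson trancl_into_trancl)
qed

lemma trancl_closed_target:
  assumes "(x, y) \<in> r\<^sup>+" "y \<in> Z" "\<And>a b. (a, b) \<in> r \<Longrightarrow> b \<in> Z \<Longrightarrow> a \<in> Z"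
  shows "x \<in> Z \<and> (x, y) \<in> (r \<inter> Z \<times> Z)\<^sup>+"
  using assms(1,2)
proof (induction rule: converse_trancl_induct)
  case (base x)
  then show ?case using assms(3) by blast
next
  case (step x z)
  then have "x \<in> Z" using assms(3) by blast
  then have "(x, z) \<in> r \<inter> Z \<times> Z" using step by blast
  with step \<open>x \<in> Z\<close> show ?case by (meson trancl_into_trancl2)
qed

lemma cycle_avoids_sink:
  assumes "(y, y) \<in> r\<^sup>+" "\<And>b. (w, b) \<notin> r"
  shows "(y, y) \<in> (r \<inter> (- {w}) \<times> (- {w}))\<^sup>+"
proof -
  have "y \<noteq> w" using assms by (metis tranclD)
  then have "y \<in> - {w}" by simp
  from trancl_closed_target[OF assms(1) this] assms(2) show ?thesis by blast
qed

text \<open>No cycle passes through both \<open>Z\<close> and its complement, because \<open>Z\<close> is never left.\<close>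

lemma cycle_in_closed_or_complement:
  assumes "(y, y) \<in> r\<^sup>+" "\<And>a b. (a, b) \<in> r \<Longrightarrow> a \<in> Z \<Longrightarrow> b \<in> Z"
  shows "(y, y) \<in> (r \<inter> Z \<times> Z)\<^sup>+ \<or> (y, y) \<in> (r \<inter> (- Z) \<times> (- Z))\<^sup>+"
proof (cases "y \<in> Z")
  case True
  from trancl_closed_source[of y y r Z, OF assms(1) this] assms(2) show ?thesis by blast
next
  case False
  then have "y \<in> - Z" by simp
  from trancl_closed_target[OF assms(1) this] assms(2) show ?thesis by blast
qed

text \<open>\<open>W\<close> was won with \<open>w\<close> as an additional exit. Once
  \<open>w\<close> moves into \<open>X\<close> it has no allowed edge inside the region, so it lies
  on no cycle.\<close>

lemma wins_region_insert:
  assumes W: "wins_region E P pr b (insert w X) W s"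
    and w: "w \<notin> W"
    and disj: "W \<inter> X = {}" "w \<notin> X"
    and own: "w \<in> P \<Longrightarrow> (w, x) \<in> E \<and> x \<in> X"
    and opp: "w \<notin> P \<Longrightarrow> E `` {w} \<subseteq> X"
  shows "wins_region E P pr b X (insert w W) (s(w := x))"
  unfolding wins_region_def
proof (intro conjI allI impI)
  show "\<forall>a\<in>insert w W \<inter> P. (a, (s(w := x)) a) \<in> E \<and> (s(w := x)) a \<in> insert w W \<union> X"
    using W w own unfolding wins_region_def by auto
  show "\<forall>a\<in>insert w W - P. E `` {a} \<subseteq> insert w W \<union> X"
    using W w opp unfolding wins_region_def by auto
next
  fix y assume y: "even (pr y) \<noteq> b"
  let ?r = "strat_edges E P pr (s(w := x)) (insert w W) (pr y)"
  have "(w, z) \<notin> ?r" for z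
    using disj own opp by (auto simp: strat_edges_def)
  moreover have "?r \<inter> (- {w}) \<times> (- {w}) \<subseteq> strat_edges E P pr s W (pr y)"
    by (auto simp: strat_edges_def)
  ultimately show "(y, y) \<notin> ?r\<^sup>+"
    using W y cycle_avoids_sink[of y ?r w] trancl_mono
    unfolding wins_region_def by metis
qed

text \<open>A cycle dominated by the wrong parity has least priority different from
  \<open>pr w\<close>, hence larger, so it avoids \<open>w\<close> and already exists in
  \<open>W\<close>.\<close>

lemma wins_region_insert_min:
  assumes W: "wins_region E P pr b (insert w X) W s"
    and w: "w \<notin> W" "even (pr w) = b" "\<And>y. y \<in> W \<Longrightarrow> pr w \<le> pr y"
    and own: "w \<in> P \<Longrightarrow> (w, x) \<in> E \<and> x \<in> insert w W"
    and opp: "w \<notin> P \<Longrightarrow> E `` {w} \<subseteq> insert w W \<union> X"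
  shows "wins_region E P pr b X (insert w W) (s(w := x))"
  unfolding wins_region_def
proof (intro conjI allI impI)
  show "\<forall>a\<in>insert w W \<inter> P. (a, (s(w := x)) a) \<in> E \<and> (s(w := x)) a \<in> insert w W \<union> X"
    using W w own unfolding wins_region_def by auto
  show "\<forall>a\<in>insert w W - P. E `` {a} \<subseteq> insert w W \<union> X"
    using W w opp unfolding wins_region_def by auto
next
  fix y assume y: "even (pr y) \<noteq> b"
  let ?r = "strat_edges E P pr (s(w := x)) (insert w W) (pr y)"
  show "(y, y) \<notin> ?r\<^sup>+"
  proof
    assume c: "(y, y) \<in> ?r\<^sup>+"
    then obtain z where "(y, z) \<in> ?r" by (meson tranclD)
    then have "y \<in> insert w W" by (auto simp: strat_edges_def)
    with w y have "pr w < pr y" by (metis insert_iff order_le_neq_trans)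
    then have "?r \<subseteq> strat_edges E P pr s W (pr y)"
      by (auto simp: strat_edges_def)
    with c W y show False unfolding wins_region_def by (metis trancl_mono)
  qed
qed

text \<open>From \<open>Z\<close> the allowed moves lead only to \<open>Z\<close> or
  \<open>X\<close>, so no allowed cycle mixes \<open>Z\<close> and \<open>W\<close>, and each cycle
  is governed by one of the two strategies.\<close>

lemma wins_region_union:
  assumes Z: "wins_region E P pr b X Z s"
    and W: "wins_region E P pr b (X \<union> Z) W s'"
    and disj: "W \<inter> Z = {}" "W \<inter> X = {}"
  shows "wins_region E P pr b X (W \<union> Z) (\<lambda>x. if x \<in> Z then s x else s' x)"
  unfolding wins_region_def
proof (intro conjI allI impI)
  let ?s = "\<lambda>x. if x \<in> Z then s x else s' x"
  show "\<forall>a\<in>(W \<union> Z) \<inter> P. (a, ?s a) \<in> E \<and> ?s a \<in> (W \<union> Z) \<union> X"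
    using Z W unfolding wins_region_def by auto
  show "\<forall>a\<in>(W \<union> Z) - P. E `` {a} \<subseteq> (W \<union> Z) \<union> X"
    using Z W unfolding wins_region_def by blast
  fix y assume y: "even (pr y) \<noteq> b"
  let ?r = "strat_edges E P pr ?s (W \<union> Z) (pr y)"
  have closed: "d \<in> Z" if "(c, d) \<in> ?r" "c \<in> Z" for c d
  proof -
    have "d \<in> Z \<union> X"
      using that Z unfolding wins_region_def strat_edges_def by (cases "c \<in> P") auto
    moreover have "d \<in> W \<union> Z" using that(1) by (auto simp: strat_edges_def)
    ultimately show ?thesis using disj by blast
  qed
  show "(y, y) \<notin> ?r\<^sup>+"
  proof
    assume "(y, y) \<in> ?r\<^sup>+"
    from cycle_in_closed_or_complement[of y ?r Z, OF this closed]
    have "(y, y) \<in> (?r \<inter> Z \<times> Z)\<^sup>+ \<or> (y, y) \<in> (?r \<inter> (- Z) \<times> (- Z))\<^sup>+" .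
    moreover have "?r \<inter> Z \<times> Z \<subseteq> strat_edges E P pr s Z (pr y)"
      by (auto simp: strat_edges_def)
    moreover have "?r \<inter> (- Z) \<times> (- Z) \<subseteq> strat_edges E P pr s' W (pr y)"
      by (auto simp: strat_edges_def)
    ultimately have "(y, y) \<in> (strat_edges E P pr s Z (pr y))\<^sup>+ \<or>
        (y, y) \<in> (strat_edges E P pr s' W (pr y))\<^sup>+"
      by (elim disjE) (blast dest: trancl_mono)+
    with Z W y show False unfolding wins_region_def by blast
  qed
qed

text \<open>The players are \<open>True\<close> (even) and \<open>False\<close>; \<open>X b\<close> are the exits that are good for \<open>b\<close>.\<close>

theorem positional_determinacy:
  fixes P :: "bool \<Rightarrow> 'v set"
  assumes "finite R"
    and "\<And>b. R \<inter> X b = {}" "X True \<inter> X False = {}"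
    and "\<And>w. w \<in> R \<Longrightarrow> E `` {w} \<subseteq> R \<union> X True \<union> X False"
    and "\<And>w. w \<in> R \<Longrightarrow> E `` {w} \<noteq> {}"
    and "\<And>w b. w \<in> R \<Longrightarrow> w \<in> P (\<not> b) \<longleftrightarrow> w \<notin> P b"
  shows "\<exists>W s. W True \<union> W False = R \<and> (\<forall>b. wins_region E (P b) pr b (X b) (W b) (s b))"
  using assms
proof (induction "card R" arbitrary: R X rule: less_induct)
  \<comment> \<open>Recursion in the manner of Zielonka: a part of \<open>R\<close> is removed and
    declared an exit of one player, which replaces the usual removal of attractors.\<close>
  case less
  note IH = less(1) and fin = less(2) and disj = less(3) and disjX = less(4)
    and out = less(5) and tot = less(6) and own = less(7)
  have X: "X b \<inter> X (\<not> b) = {}" for b using disjX by (cases b) auto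
  have out': "E `` {w} \<subseteq> R \<union> X b \<union> X (\<not> b)" if "w \<in> R" for w b
    using out[OF that] by (cases b) auto
  have combine: ?case
    if "W b \<union> W (\<not> b) = R" "wins_region E (P b) pr b (X b) (W b) s"
      "wins_region E (P (\<not> b)) pr (\<not> b) (X (\<not> b)) (W (\<not> b)) s'" for b W s s'
  proof -
    have "wins_region E (P c) pr c (X c) (W c) (if c = b then s else s')" for c
      using that by (cases "c = b") auto
    moreover have "W True \<union> W False = R" using that(1) by (cases b) auto
    ultimately show ?thesis by (intro exI[of _ W] exI[of _ "\<lambda>c. if c = b then s else s'"]) auto
  qed
  \<comment> \<open>With \<open>Z\<close> as a further exit of \<open>b\<close>, the opponent's
    region is won in the original game as it stands, that of \<open>b\<close> only up to reaching
    \<open>Z\<close>.\<close>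
  have rec: "\<exists>W s s'. W b \<union> W (\<not> b) = R - Z \<and> wins_region E (P b) pr b (X b \<union> Z) (W b) s \<and>
      wins_region E (P (\<not> b)) pr (\<not> b) (X (\<not> b)) (W (\<not> b)) s'"
    if "Z \<subseteq> R" "Z \<noteq> {}" for Z b
  proof -
    define Y where "Y = X(b := X b \<union> Z)"
    have Y: "Y b = X b \<union> Z" "Y (\<not> b) = X (\<not> b)" by (simp_all add: Y_def)
    have YTF: "Y True \<union> Y False = X True \<union> X False \<union> Z" "Y True \<inter> Y False = {}"
      using Y X[of b] disj[of "\<not> b"] that(1) by (cases b; auto)+
    have "card (R - Z) < card R"
      using that fin by (intro psubset_card_mono) auto
    moreover have "(R - Z) \<inter> Y c = {}" for c
      using disj[of c] Y by (cases "c = b") auto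
    moreover have "E `` {w} \<subseteq> (R - Z) \<union> Y True \<union> Y False" if "w \<in> R - Z" for w
      using out[of w] that YTF(1) by blast
    ultimately have "\<exists>W s. W True \<union> W False = R - Z \<and>
        (\<forall>c. wins_region E (P c) pr c (Y c) (W c) (s c))"
      using fin tot own YTF(2) by (intro IH) auto
    then obtain W s where "W True \<union> W False = R - Z"
      and s: "\<And>c. wins_region E (P c) pr c (Y c) (W c) (s c)" by blast
    then have W: "W b \<union> W (\<not> b) = R - Z" by (cases b) (simp_all add: Un_commute)
    have "wins_region E (P b) pr b (X b \<union> Z) (W b) (s b)"
      "wins_region E (P (\<not> b)) pr (\<not> b) (X (\<not> b)) (W (\<not> b)) (s (\<not> b))"
      using s[of b] s[of "\<not> b"] unfolding Y .
    with W show ?thesis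
      by (intro exI[of _ W] exI[of _ "s b"] exI[of _ "s (\<not> b)"] conjI)
  qed
  show ?case
  proof (cases "R = {}")
    case True
    then show ?thesis
      by (intro combine[of "\<lambda>_. {}" True]) (simp_all add: wins_region_empty)
  next
    case nonempty: False
    show ?thesis
    \<comment> \<open>First case: some vertex is won by \<open>b\<close> in one move, because
      \<open>b\<close> owns it and can exit favourably or the other player owns it and has no
      choice.\<close>
    proof (cases "\<exists>w\<in>R. \<exists>b. if w \<in> P b then E `` {w} \<inter> X b \<noteq> {} else E `` {w} \<subseteq> X b")
      case True
      then obtain w b where w: "w \<in> R"
        and wb: "if w \<in> P b then E `` {w} \<inter> X b \<noteq> {} else E `` {w} \<subseteq> X b" by blast
      then obtain x where x: "w \<in> P b \<Longrightarrow> (w, x) \<in> E \<and> x \<in> X b" by (cases "w \<in> P b") auto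
      from rec[of "{w}" b] w obtain W s s' where W: "W b \<union> W (\<not> b) = R - {w}"
        and Wb: "wins_region E (P b) pr b (insert w (X b)) (W b) s"
        and Wn: "wins_region E (P (\<not> b)) pr (\<not> b) (X (\<not> b)) (W (\<not> b)) s'" by auto
      have "wins_region E (P b) pr b (X b) (insert w (W b)) (s(w := x))"
        using Wb W w x wb disj[of b] by (intro wins_region_insert) auto
      then show ?thesis
        using Wn W w by (intro combine[of "W(b := insert w (W b))" b "s(w := x)" s']) auto
    next
      case False
      then have stay: "w \<in> P b \<Longrightarrow> E `` {w} \<inter> X b = {}" "w \<notin> P b \<Longrightarrow> \<not> E `` {w} \<subseteq> X b"
        if "w \<in> R" for w b using that by metis+
      \<comment> \<open>A vertex of least priority becomes an exit for the player \<open>b\<close>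
        whom this priority favours.\<close>
      obtain w where w: "w \<in> R" and min: "\<And>y. y \<in> R \<Longrightarrow> pr w \<le> pr y"
        using ex_has_least_nat[of "\<lambda>w. w \<in> R" _ pr] nonempty by blast
      define b where "b = even (pr w)"
      from rec[of "{w}" b] w obtain W s s' where W: "W b \<union> W (\<not> b) = R - {w}"
        and Wb: "wins_region E (P b) pr b (insert w (X b)) (W b) s"
        and Wn: "wins_region E (P (\<not> b)) pr (\<not> b) (X (\<not> b)) (W (\<not> b)) s'" by auto
      show ?thesis
      proof (cases "W (\<not> b) = {}")
        \<comment> \<open>With no region left to the opponent, \<open>b\<close> wins all of
          \<open>R\<close>, since seeing \<open>w\<close> infinitely often is good for
          \<open>b\<close>.\<close>
        case True
        with W w have R: "R = insert w (W b)" "w \<notin> W b" by auto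
        obtain x where x: "w \<in> P b \<Longrightarrow> (w, x) \<in> E \<and> x \<in> R"
        proof (cases "w \<in> P b")
          case True
          \<comment> \<open>As no vertex is won in one move, the successors of \<open>w\<close> are
            not all exits of the opponent and none is an exit of \<open>b\<close>, so one lies in
            \<open>R\<close>.\<close>
          then have "\<not> E `` {w} \<subseteq> X (\<not> b)" "E `` {w} \<inter> X b = {}"
            using stay[OF w] own[OF w] by auto
          then obtain x where "(w, x) \<in> E" "x \<in> R" using out'[OF w, of b] by blast
          then show ?thesis using that by blast
        qed blast
        have "E `` {w} \<inter> X (\<not> b) = {}" if "w \<notin> P b"
          using stay(1)[OF w, of "\<not> b"] own[OF w] that by auto
        then have "wins_region E (P b) pr b (X b) (insert w (W b)) (s(w := x))"
          using Wb R x out'[OF w, of b] min by (intro wins_region_insert_min) (auto simp: b_def)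
        then show ?thesis
          using R(1) by (intro combine[of "\<lambda>c. if c = b then R else {}" b "s(w := x)" s'])
            (simp_all add: wins_region_empty)
      next
        case False
        \<comment> \<open>The opponent's region \<open>Z\<close> did not use \<open>w\<close> as an
          exit, so it is won within \<open>R\<close>. Solving \<open>R - Z\<close> with
          \<open>Z\<close> as an exit of the opponent and then adding \<open>Z\<close> to the
          opponent's part settles \<open>R\<close>.\<close>
        define Z where "Z = W (\<not> b)"
        have Z: "Z \<subseteq> R" "Z \<noteq> {}" using False W by (auto simp: Z_def)
        from rec[OF Z, of "\<not> b"] obtain W' t t' where W': "W' (\<not> b) \<union> W' b = R - Z"
          and Wn': "wins_region E (P (\<not> b)) pr (\<not> b) (X (\<not> b) \<union> Z) (W' (\<not> b)) t"
          and Wb': "wins_region E (P b) pr b (X b) (W' b) t'" by auto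
        have "W' (\<not> b) \<inter> Z = {}" "W' (\<not> b) \<inter> X (\<not> b) = {}" using W' disj[of "\<not> b"] by auto
        then show ?thesis using wins_region_union[OF Wn[folded Z_def] Wn'] Wb' W' Z
          by (intro combine[of "W'(\<not> b := W' (\<not> b) \<union> Z)" b t' "\<lambda>x. if x \<in> Z then s' x else t x"])
            auto
      qed
    qed
  qed
qed


section \<open>Lexicographic order on measures and the function \<open>prog\<close>\<close>

lemma nat_list_le_pointwise:
  fixes xs ys :: "nat list"
  assumes "length xs = length ys" "\<And>i. i < length xs \<Longrightarrow> xs ! i \<le> ys ! i"
  shows "xs \<le> ys"
  using assms
proof (induction rule: list_induct2)
  case (Cons x xs y ys)
  from Cons.prems[of 0] have "x \<le> y" by simp
  moreover have "xs \<le> ys" using Cons.prems[of "Suc _"] by (intro Cons.IH) simp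
  ultimately show ?case by auto
qed simp

lemma take_mono_lex: "xs \<le> ys \<Longrightarrow> take n xs \<le> take n (ys :: 'a :: linorder list)"
proof (induction n arbitrary: xs ys)
  case (Suc n)
  then show ?case by (cases xs; cases ys) auto
qed simp

lemma restr_mono: "x \<le> y \<Longrightarrow> restr p x \<le> restr p y"
  by (cases x; cases y) (auto intro: take_mono_lex)

text \<open>Zeros at the even positions are built in, so estimates on \<open>f\<close> are needed at
  odd positions only.\<close>

definition tuple :: "'v game \<Rightarrow> (nat \<Rightarrow> nat) \<Rightarrow> pm" where
  "tuple G f = Tup (map (\<lambda>i. if even i then 0 else f i) [0..<pm_dim G])"

lemma tuple_neq_Top [simp]: "tuple G f \<noteq> Top"
  by (simp add: tuple_def)

lemma restr_tuple_le:
  assumes "\<And>i. odd i \<Longrightarrow> i \<le> p \<Longrightarrow> f i \<le> g i"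
  shows "restr p (tuple G f) \<le> restr p (tuple G g)"
  using assms by (auto simp: tuple_def intro!: nat_list_le_pointwise)

lemma restr_tuple_less:
  assumes "\<And>i. odd i \<Longrightarrow> i \<le> p \<Longrightarrow> f i \<le> g i" "odd p" "p < pm_dim G" "f p < g p"
  shows "restr p (tuple G f) < restr p (tuple G g)"
proof -
  let ?h = "\<lambda>f. map (\<lambda>i. if even i then 0 else f i) [0..<pm_dim G]"
  have "take (Suc p) (?h f) ! p \<noteq> take (Suc p) (?h g) ! p" using assms(2-4) by simp
  then have "restr p (tuple G f) \<noteq> restr p (tuple G g)"
    unfolding tuple_def restr.simps pm.inject by metis
  with restr_tuple_le[of p f g G] assms(1) show ?thesis by (metis order_le_neq_trans)
qed

lemma tuple_in_pm_set: "(\<And>i. odd i \<Longrightarrow> f i \<le> card (prio_eq G i)) \<Longrightarrow> tuple G f \<in> pm_set G"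
  by (auto simp: tuple_def pm_set_def)

lemma pm_set_cases:
  assumes "m \<in> pm_set G" "m \<noteq> Top"
  obtains f where "m = tuple G f" "\<And>i. f i \<le> card (prio_eq G i)"
proof -
  from assms obtain a where a: "m = Tup a" "length a = pm_dim G"
    "\<And>i. i < pm_dim G \<Longrightarrow> if even i then a ! i = 0 else a ! i \<le> card (prio_eq G i)"
    by (auto simp: pm_set_def)
  \<comment> \<open>The value \<open>0\<close> beyond the dimension makes the cardinality bound hold
    at every index.\<close>
  let ?f = "\<lambda>i. if i < pm_dim G then a ! i else 0"
  have "a = map (\<lambda>i. if even i then 0 else ?f i) [0..<pm_dim G]"
    using a(2) a(3) by (intro nth_equalityI) simp_all
  moreover have "?f i \<le> card (prio_eq G i)" for i using a(3)[of i] by (auto split: if_splits)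
  ultimately show ?thesis using that[of ?f] a(1) unfolding tuple_def by blast
qed

text \<open>The order on all of \<open>pm\<close> is not well-founded, since lists of growing length
  can descend forever; finiteness provides the least element in \<open>prog\<close>.\<close>

lemma finite_pm_set: "finite (pm_set G)"
proof -
  define N where "N = (\<Sum>i<pm_dim G. card (prio_eq G i))"
  have N: "n \<le> N" if "i < pm_dim G" "n \<le> card (prio_eq G i)" for n i
    using that member_le_sum[of i "{..<pm_dim G}" "\<lambda>i. card (prio_eq G i)"] by (simp add: N_def)
  have "set a \<subseteq> {..N}" if "Tup a \<in> pm_set G" for a
  proof
    fix n assume "n \<in> set a"
    then obtain i where "i < length a" "n = a ! i" by (auto simp: in_set_conv_nth)
    with that have "i < pm_dim G" "n \<le> card (prio_eq G i)"
      by (auto simp: pm_set_def split: if_splits)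
    then show "n \<in> {..N}" using N by simp
  qed
  then have "pm_set G \<subseteq> insert Top (Tup ` {a. set a \<subseteq> {..N} \<and> length a = pm_dim G})"
    by (auto simp: pm_set_def)
  then show ?thesis
    by (rule finite_subset) (simp add: finite_lists_length_eq)
qed

definition dominates :: "nat \<Rightarrow> pm \<Rightarrow> pm \<Rightarrow> bool" where
  "dominates p x m \<longleftrightarrow>
    (if even p then restr p x \<le> restr p m else restr p x < restr p m \<or> (m = Top \<and> x = Top))"

lemma dominates_Top: "dominates p x Top"
  by (cases x) (auto simp: dominates_def less_pm_def)

lemma dominates_mono:
  assumes "dominates p x m" "m \<noteq> Top" "restr p m \<le> restr p m'"
  shows "dominates p x m'"
  using assms by (auto simp: dominates_def split: if_splits)

lemma prog_Least: "prog G \<rho> v w = (LEAST m. m \<in> pm_set G \<and> dominates (prio G v) (\<rho> w) m)"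
  by (simp add: prog_def dominates_def)

lemma prog_Min: "prog G \<rho> v w = Min {m \<in> pm_set G. dominates (prio G v) (\<rho> w) m}"
proof -
  have "Top \<in> pm_set G" by (simp add: pm_set_def)
  then show ?thesis
    unfolding prog_Least using dominates_Top by (intro Least_Min) (auto simp: finite_pm_set)
qed

lemma prog_le: "m \<in> pm_set G \<Longrightarrow> dominates (prio G v) (\<rho> w) m \<Longrightarrow> prog G \<rho> v w \<le> m"
  unfolding prog_Min by (intro Min_le) (auto simp: finite_pm_set)

lemma prog_in_pm_set: "prog G \<rho> v w \<in> pm_set G"
  and dominates_prog: "dominates (prio G v) (\<rho> w) (prog G \<rho> v w)"
proof -
  have "Top \<in> pm_set G" by (simp add: pm_set_def)
  then have "prog G \<rho> v w \<in> {m \<in> pm_set G. dominates (prio G v) (\<rho> w) m}"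
    unfolding prog_Min using dominates_Top by (intro Min_in) (auto simp: finite_pm_set)
  then show "prog G \<rho> v w \<in> pm_set G" "dominates (prio G v) (\<rho> w) (prog G \<rho> v w)" by auto
qed

lemma pm_le_Top [simp]: "x \<le> Top"
  by (cases x) auto

lemma Top_le_iff [simp]: "Top \<le> x \<longleftrightarrow> x = Top"
  by (cases x) auto

section \<open>An upper bound on measures from a strategy of even\<close>

text \<open>The empty path is allowed, so a \<open>w\<close> in \<open>W\<close> counts itself at
  \<open>i = pr w\<close>. The set is empty when \<open>w\<close> is outside \<open>W\<close> or
  \<open>pr w < i\<close>, which covers moves to exits.\<close>

definition visits ::
  "('v \<times> 'v) set \<Rightarrow> 'v set \<Rightarrow> ('v \<Rightarrow> nat) \<Rightarrow> ('v \<Rightarrow> 'v) \<Rightarrow> 'v set \<Rightarrow> 'v \<Rightarrow> nat \<Rightarrow> 'v set" where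
  "visits E P pr s W w i = {y \<in> W. pr y = i \<and> (w, y) \<in> (strat_edges E P pr s W i)\<^sup>*}"

text \<open>A path from \<open>x\<close> is extended at the front by the edge from \<open>w\<close>.
  If \<open>x\<close> is no permitted target of that edge, the left-hand set is empty.\<close>

lemma visits_subset:
  assumes "w \<in> W" "(w, x) \<in> E" "w \<in> P \<Longrightarrow> x = s w" "i \<le> pr w"
  shows "visits E P pr s W x i \<subseteq> visits E P pr s W w i"
proof
  fix y assume y: "y \<in> visits E P pr s W x i"
  then have "(x, y) \<in> (strat_edges E P pr s W i)\<^sup>*" "y \<in> W" "pr y = i"
    by (auto simp: visits_def)
  then have "x \<in> W" "i \<le> pr x"
    by (auto elim!: converse_rtranclE simp: strat_edges_def)
  then have "(w, x) \<in> strat_edges E P pr s W i" using assms by (auto simp: strat_edges_def)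
  with y show "y \<in> visits E P pr s W w i" by (auto simp: visits_def)
qed

text \<open>\<open>w\<close> counts itself but is not counted from \<open>x\<close>: a path back
  would close a cycle dominated by its odd priority, which a winning \<open>s\<close> of even
  excludes.\<close>

lemma visits_psubset:
  assumes "wins_region E P pr True X W s"
    and "w \<in> W" "(w, x) \<in> E" "w \<in> P \<Longrightarrow> x = s w" "odd (pr w)"
  shows "visits E P pr s W x (pr w) \<subset> visits E P pr s W w (pr w)"
proof -
  have "w \<notin> visits E P pr s W x (pr w)"
  proof
    assume *: "w \<in> visits E P pr s W x (pr w)"
    then have xw: "(x, w) \<in> (strat_edges E P pr s W (pr w))\<^sup>*" by (auto simp: visits_def)
    then have "x \<in> W" "pr w \<le> pr x"
      using assms(2) by (auto elim!: converse_rtranclE simp: strat_edges_def)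
    then have "(w, x) \<in> strat_edges E P pr s W (pr w)" using assms by (auto simp: strat_edges_def)
    with xw have "(w, w) \<in> (strat_edges E P pr s W (pr w))\<^sup>+" by (rule rtrancl_into_trancl2[rotated])
    with assms show False unfolding wins_region_def by auto
  qed
  moreover have "w \<in> visits E P pr s W w (pr w)" using assms(2) by (auto simp: visits_def)
  ultimately show ?thesis using visits_subset[of w W x E P s "pr w" pr] assms by auto
qed

text \<open>Saturated below \<open>k\<close>: the largest value of a vertex of priority below \<open>k\<close> that is not \<open>Top\<close>.\<close>

definition bound :: "'v game \<Rightarrow> nat \<Rightarrow> 'v set \<Rightarrow> ('v \<Rightarrow> 'v) \<Rightarrow> 'v \<Rightarrow> pm" where
  "bound G k W s w = tuple G (\<lambda>i. if i < k then card (prio_eq G i)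
     else card (visits (edges G) (even_verts G) (prio G) s W w i))"

lemma finite_succs: "parity_game G \<Longrightarrow> finite (succs G v)"
  and succs_nonempty: "parity_game G \<Longrightarrow> v \<in> verts G \<Longrightarrow> succs G v \<noteq> {}"
  and succs_subset: "parity_game G \<Longrightarrow> succs G v \<subseteq> verts G"
  unfolding succs_def parity_game_def by (auto intro: finite_subset)

lemma prio_less_pm_dim: "parity_game G \<Longrightarrow> v \<in> verts G \<Longrightarrow> prio G v < pm_dim G"
  by (simp add: pm_dim_def parity_game_def less_Suc_eq_le)

lemma finite_prio_eq: "parity_game G \<Longrightarrow> finite (prio_eq G i)"
  by (simp add: prio_eq_def parity_game_def)

lemma visits_subset_prio_eq: "W \<subseteq> verts G \<Longrightarrow> visits E P (prio G) s W w i \<subseteq> prio_eq G i \<inter> W"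
  by (auto simp: visits_def prio_eq_def)

lemma bound_in_pm_set:
  assumes "parity_game G" "W \<subseteq> verts G"
  shows "bound G k W s w \<in> pm_set G"
  unfolding bound_def
proof (rule tuple_in_pm_set)
  fix i
  have "card (visits (edges G) (even_verts G) (prio G) s W w i) \<le> card (prio_eq G i)"
    using visits_subset_prio_eq[OF assms(2)] finite_prio_eq[OF assms(1)] by (intro card_mono) blast+
  then show "(if i < k then card (prio_eq G i)
    else card (visits (edges G) (even_verts G) (prio G) s W w i)) \<le> card (prio_eq G i)" by simp
qed

text \<open>Along moves allowed by \<open>s\<close> the bound is itself a progress measure: up to
  position \<open>prio G w\<close> its entries do not grow from \<open>w\<close> to
  \<open>x\<close>, and at an odd priority the last of them drops. So it is a candidate in the
  minimum.\<close>

lemma prog_le_bound: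
  assumes G: "parity_game G" and W: "wins_region (edges G) (even_verts G) (prio G) True X W s"
    "W \<subseteq> verts G"
    and w: "w \<in> W" "k \<le> prio G w" "x \<in> succs G w" "w \<in> even_verts G \<Longrightarrow> x = s w"
    and le: "\<rho> x \<le> bound G k W s x"
  shows "prog G \<rho> w x \<le> bound G k W s w"
proof (rule prog_le[OF bound_in_pm_set[OF G W(2)]])
  let ?p = "prio G w" and ?v = "visits (edges G) (even_verts G) (prio G) s W"
  have wx: "(w, x) \<in> edges G" using w by (simp add: succs_def)
  have fin: "finite (?v w i)" for i
    using visits_subset_prio_eq[OF W(2)] finite_prio_eq[OF G] by (meson finite_Int finite_subset)
  have mono: "card (?v x i) \<le> card (?v w i)" if "i \<le> ?p" for i
    using that w wx fin by (intro card_mono visits_subset) auto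
  have "restr ?p (bound G k W s x) \<le> restr ?p (bound G k W s w)"
    unfolding bound_def using mono by (intro restr_tuple_le) auto
  moreover have "restr ?p (bound G k W s x) < restr ?p (bound G k W s w)" if "odd ?p"
  proof -
    have "card (?v x ?p) < card (?v w ?p)"
      using visits_psubset[OF W(1) w(1) wx] w that fin by (intro psubset_card_mono) auto
    then show ?thesis
      unfolding bound_def using mono that w W(2) prio_less_pm_dim[OF G, of w]
      by (intro restr_tuple_less) auto
  qed
  moreover have "restr ?p (\<rho> x) \<le> restr ?p (bound G k W s x)" using le by (rule restr_mono)
  ultimately show "dominates ?p (\<rho> x) (bound G k W s w)"
    by (auto simp: dominates_def)
qed

text \<open>All positions up to \<open>prio G z\<close> are saturated in the bound, so there it is
  at least any value other than \<open>Top\<close> and meets the same condition. Minimality of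
  \<open>prog\<close> then compares the full tuples.\<close>

lemma prog_le_bound_low:
  assumes G: "parity_game G" "W \<subseteq> verts G" and z: "prio G z < k" and "prog G \<rho> z x \<noteq> Top"
  shows "prog G \<rho> z x \<le> bound G k W s z"
proof (rule prog_le[OF bound_in_pm_set[OF G]])
  obtain f where f: "prog G \<rho> z x = tuple G f" "\<And>i. f i \<le> card (prio_eq G i)"
    using pm_set_cases[OF prog_in_pm_set assms(4)] by blast
  have "restr (prio G z) (prog G \<rho> z x) \<le> restr (prio G z) (bound G k W s z)"
    unfolding f(1) bound_def using z f(2) by (intro restr_tuple_le) auto
  with dominates_prog assms(4) show "dominates (prio G z) (\<rho> x) (bound G k W s z)"
    by (rule dominates_mono)
qed

lemma lift_cases:
  assumes "parity_game G" "v \<in> verts G"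
  obtains "lift G \<rho> v v = \<rho> v" | x where "x \<in> succs G v" "lift G \<rho> v v = prog G \<rho> v x"
    "v \<in> even_verts G \<Longrightarrow> \<forall>y\<in>succs G v. prog G \<rho> v x \<le> prog G \<rho> v y"
proof -
  let ?S = "prog G \<rho> v ` succs G v"
  have S: "finite ?S" "?S \<noteq> {}"
    using finite_succs[OF assms(1)] succs_nonempty[OF assms] by auto
  define m where "m = (if v \<in> even_verts G then Min ?S else Max ?S)"
  have "m \<in> ?S" using S Min_in Max_in by (auto simp: m_def)
  then obtain x where x: "x \<in> succs G v" "m = prog G \<rho> v x" by blast
  have "v \<in> even_verts G \<Longrightarrow> \<forall>y\<in>succs G v. prog G \<rho> v x \<le> prog G \<rho> v y"
    using S unfolding x(2)[symmetric] by (auto simp: m_def)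
  moreover have "lift G \<rho> v v = max (\<rho> v) m" by (simp add: lift_def m_def)
  ultimately show ?thesis using that x by (metis max_def)
qed

lemma lift_other: "w \<noteq> v \<Longrightarrow> lift G \<rho> v w = \<rho> w"
  by (simp add: lift_def)

text \<open>Induction along the lifting sequence: vertices of \<open>W\<close> are controlled by the
  strategy moves, vertices below \<open>k\<close> by saturation. The latter are carried along as the
  exits of \<open>W\<close>.\<close>

lemma lifting_run_bound:
  assumes G: "parity_game G"
    and W: "wins_region (edges G) (even_verts G) (prio G) True {z \<in> verts G. prio G z < k} W s"
    "W \<subseteq> prio_ge G k"
    and run: "(lift_step G)\<^sup>*\<^sup>* (init_pm G) \<rho>" and "\<forall>w\<in>verts G. \<rho> w \<noteq> Top"
  shows "(\<forall>w\<in>verts G. \<rho> w \<in> pm_set G) \<and>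
    (\<forall>w\<in>W \<union> {z \<in> verts G. prio G z < k}. \<rho> w \<le> bound G k W s w)"
  using run assms(5)
proof (induction rule: rtranclp_induct)
  case base
  have init: "init_pm G w = tuple G (\<lambda>_. 0)" for w :: 'a
    by (simp add: init_pm_def tuple_def map_replicate_const)
  have "tuple G (\<lambda>_. 0) \<le> tuple G f" for f
    by (auto simp: tuple_def intro!: nat_list_le_pointwise)
  then show ?case using tuple_in_pm_set[of "\<lambda>_. 0" G] by (simp add: init bound_def)
next
  case (step \<rho> \<rho>')
  let ?L = "{z \<in> verts G. prio G z < k}"
  have Wv: "W \<subseteq> verts G" using W(2) by (auto simp: prio_ge_def)
  from step obtain v where v: "v \<in> verts G" "\<rho>' = lift G \<rho> v" "\<rho> \<le> \<rho>'"
    by (auto simp: lift_step_def lift_at_def)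
  \<comment> \<open>Measures only grow, so absence of \<open>Top\<close> after the step gives
    absence before it.\<close>
  have nt: "\<rho> w \<noteq> Top" if "w \<in> verts G" for w
    using le_funD[OF v(3), of w] step.prems that by (metis Top_le_iff)
  with step.IH have pm: "\<And>w. w \<in> verts G \<Longrightarrow> \<rho> w \<in> pm_set G"
    and le: "\<And>w. w \<in> W \<union> ?L \<Longrightarrow> \<rho> w \<le> bound G k W s w" by auto
  have "\<rho>' v \<in> pm_set G \<and> (v \<in> W \<union> ?L \<longrightarrow> \<rho>' v \<le> bound G k W s v)"
    unfolding v(2)
  proof (cases rule: lift_cases[OF G v(1), of \<rho>])
    case 1
    then show "lift G \<rho> v v \<in> pm_set G \<and> (v \<in> W \<union> ?L \<longrightarrow> lift G \<rho> v v \<le> bound G k W s v)"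
      using pm[OF v(1)] le by auto
  next
    case (2 x)
    have "lift G \<rho> v v \<le> bound G k W s v" if "v \<in> ?L"
    proof -
      have "prog G \<rho> v x \<noteq> Top" using step.prems v(1) unfolding v(2) 2(2)[symmetric] by blast
      with that show ?thesis unfolding 2(2) by (intro prog_le_bound_low[OF G Wv]) auto
    qed
    moreover have "lift G \<rho> v v \<le> bound G k W s v" if vW: "v \<in> W"
    proof -
      have kv: "k \<le> prio G v" using W(2) vW by (auto simp: prio_ge_def)
      \<comment> \<open>For even the minimum is at most the value along \<open>s v\<close>; for odd
        the successor attaining the lifted value lies in \<open>W\<close> or below \<open>k\<close>,
        as every move does.\<close>
      obtain y where y: "y \<in> succs G v" "v \<in> even_verts G \<Longrightarrow> y = s v" "y \<in> W \<union> ?L"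
        "prog G \<rho> v x \<le> prog G \<rho> v y"
      proof (cases "v \<in> even_verts G")
        case True
        then have "s v \<in> succs G v" "s v \<in> W \<union> ?L"
          using W(1) vW by (auto simp: wins_region_def succs_def)
        then show ?thesis using 2 True that[of "s v"] by blast
      next
        case False
        then have "x \<in> W \<union> ?L" using W(1) vW 2(1) by (auto simp: wins_region_def succs_def)
        then show ?thesis using 2 False that[of x] by blast
      qed
      have "prog G \<rho> v y \<le> bound G k W s v"
        by (rule prog_le_bound[OF G W(1) Wv vW kv y(1)]) (use y le in auto)
      with y(4) show ?thesis unfolding 2(2) by (rule order_trans)
    qed
    ultimately show "lift G \<rho> v v \<in> pm_set G \<and> (v \<in> W \<union> ?L \<longrightarrow> lift G \<rho> v v \<le> bound G k W s v)"
      using prog_in_pm_set unfolding 2 by auto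
  qed
  moreover have "\<rho>' w = \<rho> w" if "w \<noteq> v" for w using that unfolding v(2) by (rule lift_other)
  ultimately have "\<rho>' w \<in> pm_set G \<and> (w \<in> W \<union> ?L \<longrightarrow> \<rho>' w \<le> bound G k W s w)"
    if "w \<in> verts G" for w
    using pm[OF that] le[of w] by (cases "w = v") simp_all
  then show ?case using Wv by blast
qed

text \<open>At an even priority \<open>\<rho> w\<close> is itself a candidate in the
  minimum.\<close>

lemma prog_Top_odd:
  assumes "prog G \<rho> v w = Top" "\<rho> w \<in> pm_set G" "\<rho> w \<noteq> Top"
  shows "odd (prio G v)"
proof
  assume "even (prio G v)"
  then have "dominates (prio G v) (\<rho> w) (\<rho> w)" by (simp add: dominates_def)
  with assms prog_le show False by (metis Top_le_iff)
qed

text \<open>At position \<open>k\<close> the bound misses at least \<open>v\<close>, so it lies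
  strictly below the tuple of all cardinalities. That tuple is then a candidate for
  \<open>prog\<close> below \<open>Top\<close>.\<close>

lemma prog_Top_not_bounded:
  assumes G: "parity_game G" and v: "v \<in> verts G" "prio G v = k" "odd k" "v \<notin> W" "W \<subseteq> verts G"
    and "prog G \<rho> v w = Top" "\<rho> w \<le> bound G k W s u"
  shows False
proof -
  let ?f = "\<lambda>i. card (prio_eq G i)" and ?v = "visits (edges G) (even_verts G) (prio G) s W"
  have fin: "finite (prio_eq G i)" for i using G by (rule finite_prio_eq)
  have "v \<in> prio_eq G k" using v by (simp add: prio_eq_def)
  then have "?v u k \<subset> prio_eq G k" using visits_subset_prio_eq[OF v(5)] v(4) by fast
  then have "card (?v u k) < ?f k" using fin by (intro psubset_card_mono)
  then have "restr k (bound G k W s u) < restr k (tuple G ?f)"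
    unfolding bound_def using v prio_less_pm_dim[OF G v(1)] by (intro restr_tuple_less) auto
  with restr_mono[OF assms(8)] have "restr k (\<rho> w) < restr k (tuple G ?f)" by (rule order_le_less_trans)
  then have "dominates (prio G v) (\<rho> w) (tuple G ?f)" using v by (simp add: dominates_def)
  then have "prog G \<rho> v w \<le> tuple G ?f" by (intro prog_le tuple_in_pm_set) auto
  with assms(7) show False by simp
qed

section \<open>Stages and ranks of the guarded attractor\<close>

primrec attr_level :: "'v game \<Rightarrow> nat \<Rightarrow> 'v set \<Rightarrow> nat \<Rightarrow> 'v set" where
  "attr_level G k U 0 = U"
| "attr_level G k U (Suc n) = attr_level G k U n \<union>
    {x \<in> prio_ge G k. x \<in> odd_verts G \<and> succs G x \<inter> attr_level G k U n \<noteq> {}} \<union>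
    {x \<in> prio_ge G k. x \<in> even_verts G \<and> succs G x \<subseteq> attr_level G k U n}"

lemma attr_level_mono: "m \<le> n \<Longrightarrow> attr_level G k U m \<subseteq> attr_level G k U n"
  by (rule lift_Suc_mono_le) auto

lemma attr_eq_levels:
  assumes "parity_game G"
  shows "attr G k (verts G) U = (\<Union>n. attr_level G k U n)"
proof
  have "attr_level G k U n \<subseteq> attr G k (verts G) U" for n
  proof (induction n)
    case 0
    then show ?case by (auto intro: attr.base)
  next
    case (Suc n)
    show ?case
    proof
      fix x assume "x \<in> attr_level G k U (Suc n)"
      then consider "x \<in> attr_level G k U n"
        | y where "x \<in> prio_ge G k" "x \<in> odd_verts G" "y \<in> succs G x" "y \<in> attr_level G k U n"
        | "x \<in> prio_ge G k" "x \<in> even_verts G" "succs G x \<subseteq> attr_level G k U n" by auto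
      then show "x \<in> attr G k (verts G) U"
      proof cases
        case 1
        then show ?thesis using Suc by blast
      next
        case 2
        show ?thesis
          by (rule attr.odd_step[of x _ _ _ y]) (use 2 Suc in \<open>auto simp: prio_ge_def\<close>)
      next
        case 3
        show ?thesis
          by (rule attr.even_step) (use 3 Suc in \<open>auto simp: prio_ge_def\<close>)
      qed
    qed
  qed
  then show "(\<Union>n. attr_level G k U n) \<subseteq> attr G k (verts G) U" by blast
  show "attr G k (verts G) U \<subseteq> (\<Union>n. attr_level G k U n)"
  proof
    fix x assume "x \<in> attr G k (verts G) U"
    then show "x \<in> (\<Union>n. attr_level G k U n)"
    proof induction
      case (base u)
      then have "u \<in> attr_level G k U 0" by simp
      then show ?case by blast
    next
      case (odd_step u w)
      then obtain n where "w \<in> attr_level G k U n" by blast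
      with odd_step have "u \<in> attr_level G k U (Suc n)" by auto
      then show ?case by blast
    next
      case (even_step u)
      then have "\<forall>w\<in>succs G u. \<exists>n. w \<in> attr_level G k U n"
        using succs_subset[OF assms, of u] by blast
      then obtain n where n: "\<And>w. w \<in> succs G u \<Longrightarrow> w \<in> attr_level G k U (n w)" by metis
      \<comment> \<open>There are finitely many successors, so their stages have a maximum, and by
        monotonicity that stage contains them all.\<close>
      have "succs G u \<subseteq> attr_level G k U (Max (n ` succs G u))"
      proof
        fix w assume w: "w \<in> succs G u"
        then have "n w \<le> Max (n ` succs G u)" using finite_succs[OF assms] by simp
        then have "attr_level G k U (n w) \<subseteq> attr_level G k U (Max (n ` succs G u))"
          by (rule attr_level_mono)
        with n[OF w] show "w \<in> attr_level G k U (Max (n ` succs G u))" by blast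
      qed
      with even_step have "u \<in> attr_level G k U (Suc (Max (n ` succs G u)))" by auto
      then show ?case by blast
    qed
  qed
qed

text \<open>The rank is the first stage containing a vertex. Outside \<open>U\<close> odd can lower
  it and even cannot avoid doing so, which forces arrival in \<open>U\<close>.\<close>

lemma attr_rank:
  assumes "parity_game G"
  obtains f and r :: "'v \<Rightarrow> nat" where
    "\<And>x. x \<in> attr G k (verts G) U - U \<Longrightarrow> x \<in> odd_verts G \<Longrightarrow>
      f x \<in> succs G x \<inter> attr G k (verts G) U \<and> r (f x) < r x"
    "\<And>x y. x \<in> attr G k (verts G) U - U \<Longrightarrow> x \<in> even_verts G \<Longrightarrow> y \<in> succs G x \<Longrightarrow>
      y \<in> attr G k (verts G) U \<and> r y < r x"
proof -
  let ?A = "attr G k (verts G) U" and ?L = "attr_level G k U"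
  define r where "r x = (LEAST n. x \<in> ?L n)" for x
  have AL: "?L n \<subseteq> ?A" for n using attr_eq_levels[OF assms] by blast
  have r_le: "x \<in> ?L n \<Longrightarrow> r x \<le> n" for x n unfolding r_def by (rule Least_le)
  \<comment> \<open>Outside \<open>U\<close> the first stage is not \<open>0\<close>, so the vertex
    was added by a step rule whose targets lie in the stage before.\<close>
  have pred: "\<exists>m. r x = Suc m \<and> x \<in> ?L (Suc m) \<and> x \<notin> ?L m" if "x \<in> ?A - U" for x
  proof -
    from that obtain n where "x \<in> ?L n" using attr_eq_levels[OF assms] by blast
    then have x: "x \<in> ?L (r x)" unfolding r_def by (rule LeastI)
    have "r x \<noteq> 0"
    proof
      assume "r x = 0"
      with x that show False by simp
    qed
    then obtain m where m: "r x = Suc m" using not0_implies_Suc by blast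
    then have "x \<notin> ?L m" using r_le[of x m] by linarith
    with m x show ?thesis by auto
  qed
  have odd: "\<exists>y. y \<in> succs G x \<inter> ?A \<and> r y < r x" if x: "x \<in> ?A - U" "x \<in> odd_verts G" for x
  proof -
    from pred[OF x(1)] obtain m where m: "r x = Suc m" "x \<in> ?L (Suc m)" "x \<notin> ?L m" by blast
    then obtain y where "y \<in> succs G x" "y \<in> ?L m"
      using x(2) assms by (auto simp: parity_game_def)
    with m(1) AL r_le show ?thesis by (metis IntI le_imp_less_Suc subsetD)
  qed
  have even: "y \<in> ?A \<and> r y < r x"
    if x: "x \<in> ?A - U" "x \<in> even_verts G" "y \<in> succs G x" for x y
  proof -
    from pred[OF x(1)] obtain m where m: "r x = Suc m" "x \<in> ?L (Suc m)" "x \<notin> ?L m" by blast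
    then have "y \<in> ?L m" using x(2,3) assms by (auto simp: parity_game_def)
    with m(1) AL r_le show ?thesis by (metis le_imp_less_Suc subsetD)
  qed
  show ?thesis
    by (rule that[of "\<lambda>x. SOME y. y \<in> succs G x \<inter> ?A \<and> r y < r x" r])
      (use someI_ex[OF odd] even in auto)
qed

lemma attr_subset_prio_ge:
  assumes "U \<subseteq> prio_ge G k"
  shows "attr G k W U \<subseteq> prio_ge G k"
proof
  fix x assume "x \<in> attr G k W U"
  then show "x \<in> prio_ge G k" by induction (use assms in auto)
qed

section \<open>Winning plays and the strategy of odd\<close>

lemma consistent_positional:
  "consistent G (positional \<sigma>) \<pi> \<longleftrightarrow> (\<forall>i. \<pi> i \<in> odd_verts G \<longrightarrow> \<pi> (Suc i) = \<sigma> (\<pi> i))"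
  by (simp add: consistent_def positional_def)

text \<open>If the least recurring priority \<open>p\<close> were even, then after the last smaller
  priority some vertex of priority \<open>p\<close> would repeat, giving a forbidden cycle.\<close>

lemma odd_wins_in_region:
  assumes G: "parity_game G"
    and W: "wins_region (edges G) (odd_verts G) (prio G) False X W s" "W \<subseteq> verts G"
    and \<pi>: "play G \<pi>" "\<And>i. n \<le> i \<Longrightarrow> \<pi> i \<in> W"
      "\<And>i. n \<le> i \<Longrightarrow> \<pi> i \<in> odd_verts G \<Longrightarrow> \<pi> (Suc i) = s (\<pi> i)"
  shows "\<not> even_wins G \<pi>"
proof
  let ?Q = "\<lambda>p. \<exists>\<^sub>\<infinity>i. prio G (\<pi> i) = p"
  define p where "p = (LEAST p. ?Q p)"
  assume "even_wins G \<pi>"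
  then have even: "even p" by (simp add: even_wins_def p_def)
  \<comment> \<open>Some vertex of the finite \<open>W\<close> recurs, so the \<open>LEAST\<close>
    in the winning condition ranges over a nonempty set.\<close>
  have "finite W" using G W(2) by (auto simp: parity_game_def intro: finite_subset)
  have "\<exists>\<^sub>\<infinity>i. n \<le> i" by (simp add: INFM_nat_le) (meson nat_le_linear)
  then have "\<exists>\<^sub>\<infinity>i. \<exists>y\<in>W. \<pi> i = y" by (rule INFM_mono) (use \<pi>(2) in auto)
  then obtain y0 where "\<exists>\<^sub>\<infinity>i. \<pi> i = y0"
    using INFM_finite_Bex_distrib[OF \<open>finite W\<close>, of "\<lambda>y i. \<pi> i = y"] by auto
  then have "?Q (prio G y0)" by (rule INFM_mono) auto
  then have Qp: "?Q p" unfolding p_def by (rule LeastI)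
  have "\<forall>q<p. \<forall>\<^sub>\<infinity>i. prio G (\<pi> i) \<noteq> q"
    using not_less_Least[of _ ?Q] by (auto simp: p_def not_INFM)
  then have "\<forall>\<^sub>\<infinity>i. \<forall>q\<in>{..<p}. prio G (\<pi> i) \<noteq> q"
    by (subst MOST_finite_Ball_distrib) auto
  then obtain N where N: "\<And>i. N < i \<Longrightarrow> p \<le> prio G (\<pi> i)"
    unfolding MOST_nat by (metis lessThan_iff not_le)
  have "\<exists>\<^sub>\<infinity>i. prio G (\<pi> i) = p \<and> n \<le> i \<and> N < i"
    unfolding INFM_nat
  proof
    fix m
    from Qp obtain i where "max m (max n N) < i" "prio G (\<pi> i) = p" unfolding INFM_nat by blast
    then show "\<exists>i>m. prio G (\<pi> i) = p \<and> n \<le> i \<and> N < i" by auto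
  qed
  then have "\<exists>\<^sub>\<infinity>i. \<exists>y\<in>W. \<pi> i = y \<and> prio G y = p \<and> n \<le> i \<and> N < i"
    by (rule INFM_mono) (use \<pi>(2) in auto)
  then obtain y where y: "\<exists>\<^sub>\<infinity>i. \<pi> i = y \<and> prio G y = p \<and> n \<le> i \<and> N < i"
    using INFM_finite_Bex_distrib[OF \<open>finite W\<close>, of "\<lambda>y i. \<pi> i = y \<and> prio G y = p \<and> n \<le> i \<and> N < i"]
    by auto
  then obtain i where i: "\<pi> i = y" "prio G y = p" "n \<le> i" "N < i" unfolding INFM_nat by blast
  from y obtain j where j: "i < j" "\<pi> j = y" unfolding INFM_nat by blast
  let ?r = "strat_edges (edges G) (odd_verts G) (prio G) s W p"
  have edge: "(\<pi> l, \<pi> (Suc l)) \<in> ?r" if "i \<le> l" for l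
    using that i \<pi> N[of l] N[of "Suc l"] by (auto simp: strat_edges_def play_def)
  have "(\<pi> i, \<pi> l) \<in> ?r\<^sup>+" if "Suc i \<le> l" for l
    using that by (induction rule: dec_induct) (use edge in \<open>auto intro: trancl_into_trancl\<close>)
  then have "(y, y) \<in> (strat_edges (edges G) (odd_verts G) (prio G) s W (prio G y))\<^sup>+"
    using i j by (metis Suc_leI)
  with W(1) even i(2) show False unfolding wins_region_def by auto
qed

text \<open>A play entering \<open>A\<close> infinitely often sees \<open>v\<close> infinitely
  often, and the odd priority \<open>k\<close> of \<open>v\<close> is least in
  \<open>A \<union> W\<close>. Any other play finally stays in \<open>W\<close> and follows
  \<open>s\<close> there.\<close>

lemma odd_dominion_through_vertex:
  assumes G: "parity_game G" and v: "v \<in> verts G" "prio G v = k" "odd k"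
    and A_def: "A = attr G k (verts G) {v}"
    and W: "wins_region (edges G) (odd_verts G) (prio G) False A W s" "W \<subseteq> prio_ge G k" "W \<inter> A = {}"
    and u: "v \<in> odd_verts G \<Longrightarrow> u \<in> succs G v \<inter> (A \<union> W)"
    and v_even: "v \<in> even_verts G \<Longrightarrow> succs G v \<subseteq> A \<union> W"
  obtains \<sigma> where "odd_strategy G (positional \<sigma>)" "closed_on G (positional \<sigma>) (A \<union> W)"
    "odd_winning_on G (positional \<sigma>) (A \<union> W)" "v \<in> odd_verts G \<Longrightarrow> \<sigma> v = u"
    "attracting G (positional \<sigma>) A {v}"
proof -
  obtain f r where f: "\<And>x. x \<in> A - {v} \<Longrightarrow> x \<in> odd_verts G \<Longrightarrow> f x \<in> succs G x \<inter> A \<and> r (f x) < (r x :: nat)"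
    and r: "\<And>x y. x \<in> A - {v} \<Longrightarrow> x \<in> even_verts G \<Longrightarrow> y \<in> succs G x \<Longrightarrow> y \<in> A \<and> r y < r x"
    using attr_rank[OF G, of k "{v}"] unfolding A_def by blast
  \<comment> \<open>Outside \<open>A \<union> W\<close> an arbitrary successor makes the strategy
    total.\<close>
  define \<sigma> where "\<sigma> x = (if x = v then u else if x \<in> A then f x else if x \<in> W then s x
    else SOME y. y \<in> succs G x)" for x
  have vA: "v \<in> A" unfolding A_def by (rule attr.base) simp
  have A: "A \<subseteq> prio_ge G k"
    unfolding A_def using v by (intro attr_subset_prio_ge) (auto simp: prio_ge_def)
  have owner: "x \<in> even_verts G \<or> x \<in> odd_verts G" if "x \<in> A \<union> W" for x
    using that A W(2) G by (auto simp: prio_ge_def parity_game_def)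
  have strat: "odd_strategy G (positional \<sigma>)"
    unfolding odd_strategy_def positional_def
  proof (intro allI ballI)
    fix h x assume x: "x \<in> odd_verts G"
    then have "succs G x \<noteq> {}" using succs_nonempty[OF G] G by (auto simp: parity_game_def)
    then have "(SOME y. y \<in> succs G x) \<in> succs G x" by (simp add: some_in_eq)
    moreover have "s x \<in> succs G x" if "x \<in> W" using W(1) that x by (auto simp: wins_region_def succs_def)
    ultimately show "\<sigma> (last (h @ [x])) \<in> succs G x"
      using x u f by (auto simp: \<sigma>_def)
  qed
  have step_A: "y \<in> A \<and> r y < r x"
    if "x \<in> A" "x \<noteq> v" "(x, y) \<in> edges G" "x \<in> odd_verts G \<Longrightarrow> y = \<sigma> x" for x y
  proof (cases "x \<in> odd_verts G")
    case True
    then show ?thesis using that f[of x] by (auto simp: \<sigma>_def)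
  next
    case False
    then show ?thesis using that r[of x y] owner[of x] by (auto simp: succs_def)
  qed
  have step_W: "y \<in> A \<union> W"
    if "x \<in> W" "(x, y) \<in> edges G" "x \<in> odd_verts G \<Longrightarrow> y = \<sigma> x" for x y
    using that W vA by (cases "x \<in> odd_verts G") (auto simp: \<sigma>_def wins_region_def)
  have step_v: "y \<in> A \<union> W" if "(v, y) \<in> edges G" "v \<in> odd_verts G \<Longrightarrow> y = \<sigma> v" for y
    using that u v_even owner[of v] vA by (auto simp: \<sigma>_def succs_def)
  \<comment> \<open>Stated for any time \<open>i\<close>, so that it also yields a return to
    \<open>v\<close> after every later visit to \<open>A\<close>.\<close>
  have reach: "\<exists>n\<ge>i. \<pi> n = v \<and> (\<forall>j. i \<le> j \<and> j \<le> n \<longrightarrow> \<pi> j \<in> A)"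
    if \<pi>: "play G \<pi>" "consistent G (positional \<sigma>) \<pi>" and "\<pi> i \<in> A" for \<pi> i
    using that(3)
  proof (induction "r (\<pi> i)" arbitrary: i rule: less_induct)
    case less
    show ?case
    proof (cases "\<pi> i = v")
      case True
      with vA show ?thesis by (intro exI[of _ i]) auto
    next
      case False
      have "(\<pi> i, \<pi> (Suc i)) \<in> edges G" using \<pi> by (auto simp: play_def)
      moreover have "\<pi> i \<in> odd_verts G \<Longrightarrow> \<pi> (Suc i) = \<sigma> (\<pi> i)"
        using \<pi> by (simp add: consistent_positional)
      ultimately have "\<pi> (Suc i) \<in> A \<and> r (\<pi> (Suc i)) < r (\<pi> i)"
        by (rule step_A[OF less.prems False])
      then obtain n where "Suc i \<le> n" "\<pi> n = v" "\<And>j. Suc i \<le> j \<Longrightarrow> j \<le> n \<Longrightarrow> \<pi> j \<in> A"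
        using less.hyps by blast
      then show ?thesis using less.prems
        by (intro exI[of _ n]) (metis Suc_leD le_antisym not_less_eq_eq)
    qed
  qed
  have attracts: "attracting G (positional \<sigma>) A {v}"
    unfolding attracting_def using strat reach by (metis le0 singletonI)
  have stays: "\<pi> i \<in> A \<union> W"
    if \<pi>: "play G \<pi>" "consistent G (positional \<sigma>) \<pi>" "\<pi> 0 \<in> A \<union> W" for \<pi> i
  proof (induction i)
    case (Suc i)
    have "(\<pi> i, \<pi> (Suc i)) \<in> edges G" using \<pi> by (auto simp: play_def)
    moreover have "\<pi> i \<in> odd_verts G \<Longrightarrow> \<pi> (Suc i) = \<sigma> (\<pi> i)"
      using \<pi> by (simp add: consistent_positional)
    ultimately show ?case using Suc step_A[of "\<pi> i"] step_W[of "\<pi> i"] step_v by (metis UnE UnI1)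
  qed (use \<pi> in simp)
  have "\<not> even_wins G \<pi>"
    if \<pi>: "play G \<pi>" "consistent G (positional \<sigma>) \<pi>" "\<pi> 0 \<in> A \<union> W" for \<pi>
  proof (cases "\<exists>\<^sub>\<infinity>i. \<pi> i \<in> A")
    case True
    have "\<exists>\<^sub>\<infinity>i. prio G (\<pi> i) = k"
      unfolding INFM_nat
    proof
      fix m
      from True obtain i where "m < i" "\<pi> i \<in> A" unfolding INFM_nat by blast
      moreover from this obtain n where "i \<le> n" "\<pi> n = v" using reach[OF \<pi>(1,2)] by blast
      ultimately show "\<exists>n>m. prio G (\<pi> n) = k" using v(2) by (intro exI[of _ n]) auto
    qed
    moreover have "k \<le> p" if "\<exists>\<^sub>\<infinity>i. prio G (\<pi> i) = p" for p
    proof -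
      from that obtain i where "prio G (\<pi> i) = p" unfolding INFM_nat by blast
      with stays[OF \<pi>, of i] A W(2) show ?thesis by (auto simp: prio_ge_def)
    qed
    ultimately have "(LEAST p. \<exists>\<^sub>\<infinity>i. prio G (\<pi> i) = p) = k" by (rule Least_equality)
    with v(3) show ?thesis by (simp add: even_wins_def)
  next
    case False
    then obtain n where n: "\<And>i. n < i \<Longrightarrow> \<pi> i \<notin> A" unfolding INFM_nat by blast
    have W_late: "\<pi> i \<in> W" if "Suc n \<le> i" for i using stays[OF \<pi>, of i] n[of i] that by auto
    have "\<pi> (Suc i) = s (\<pi> i)" if "Suc n \<le> i" "\<pi> i \<in> odd_verts G" for i
      using \<pi>(2) W_late[OF that(1)] n[of i] that vA by (auto simp: consistent_positional \<sigma>_def)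
    moreover have "W \<subseteq> verts G" using W(2) by (auto simp: prio_ge_def)
    ultimately show ?thesis using odd_wins_in_region[OF G W(1) _ \<pi>(1) W_late] by blast
  qed
  with stays have "closed_on G (positional \<sigma>) (A \<union> W)" "odd_winning_on G (positional \<sigma>) (A \<union> W)"
    unfolding closed_on_def odd_winning_on_def by blast+
  with strat attracts show ?thesis using that[of \<sigma>] by (simp add: \<sigma>_def)
qed

text \<open>Reaching the attractor is good for odd, falling below priority \<open>k\<close> is good for even.\<close>

lemma guarded_game_regions:
  assumes G: "parity_game G" and v: "v \<in> verts G" "prio G v = k"
    and A_def: "A = attr G k (verts G) {v}"
  obtains W0 W1 s0 s1 where "W0 \<union> W1 = prio_ge G k - A"
    "wins_region (edges G) (even_verts G) (prio G) True {z \<in> verts G. prio G z < k} W0 s0"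
    "wins_region (edges G) (odd_verts G) (prio G) False A W1 s1"
proof -
  let ?L = "{z \<in> verts G. prio G z < k}"
  let ?X = "\<lambda>b. if b then ?L else A" and ?P = "\<lambda>b. if b then even_verts G else odd_verts G"
  have A: "A \<subseteq> prio_ge G k"
    unfolding A_def using v by (intro attr_subset_prio_ge) (auto simp: prio_ge_def)
  have "\<exists>W s. W True \<union> W False = prio_ge G k - A \<and>
      (\<forall>b. wins_region (edges G) (?P b) (prio G) b (?X b) (W b) (s b))"
  proof (rule positional_determinacy)
    show "finite (prio_ge G k - A)" using G by (auto simp: prio_ge_def parity_game_def)
    show "(prio_ge G k - A) \<inter> ?X b = {}" for b by (auto simp: prio_ge_def)
    show "?X True \<inter> ?X False = {}" using A by (auto simp: prio_ge_def)
    show "edges G `` {w} \<subseteq> (prio_ge G k - A) \<union> ?X True \<union> ?X False" for w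
      using G by (auto simp: prio_ge_def parity_game_def)
    show "edges G `` {w} \<noteq> {}" if "w \<in> prio_ge G k - A" for w
      using that G unfolding parity_game_def prio_ge_def by blast
    show "w \<in> ?P (\<not> b) \<longleftrightarrow> w \<notin> ?P b" if "w \<in> prio_ge G k - A" for w b
      using that G unfolding parity_game_def prio_ge_def by auto
  qed
  then obtain W s where "W True \<union> W False = prio_ge G k - A"
    and "\<And>b. wins_region (edges G) (?P b) (prio G) b (?X b) (W b) (s b)" by blast
  from this(1) this(2)[of True] this(2)[of False] show ?thesis using that by simp
qed

section \<open>From the successors that force \<open>Top\<close> to the dominion\<close>

theorem theorem4:
  fixes G :: "'v game" and v :: 'v and k :: nat and \<rho>\<^sub>0 \<rho> :: "'v \<Rightarrow> pm"
  assumes "parity_game G"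
    and "(lift_step G)\<^sup>*\<^sup>* (init_pm G) \<rho>\<^sub>0"
    and "\<forall>w\<in>verts G. \<rho>\<^sub>0 w \<noteq> Top"
    and "lift_at G v \<rho>\<^sub>0 \<rho>"
    and "\<rho> v = Top"
    and "prio G v = k"
  shows "(v \<in> odd_verts G \<longrightarrow>
      (\<forall>\<mu>\<in>{\<rho>\<^sub>0, \<rho>}. \<forall>u\<in>succs G v. (\<forall>w\<in>succs G v. \<mu> w \<le> \<mu> u) \<longrightarrow>
        (\<exists>D. odd_dominion G D \<and> attr G k (verts G) {v} \<subseteq> D \<and> (\<forall>w\<in>D. prio G w \<ge> k) \<and>
          (\<exists>\<sigma>. odd_strategy G (positional \<sigma>) \<and>
            odd_winning_on G (positional \<sigma>) D \<and> closed_on G (positional \<sigma>) D \<and>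
            \<sigma> v = u \<and>
            attracting G (positional \<sigma>) (attr G k (verts G) {v}) {v})))) \<and>
    (v \<in> even_verts G \<longrightarrow>
      (\<exists>D. odd_dominion G D \<and> attr G k (verts G) {v} \<subseteq> D \<and> (\<forall>w\<in>D. prio G w \<ge> k) \<and>
        succs G v \<subseteq> D \<and>
        (\<exists>\<sigma>. odd_strategy G (positional \<sigma>) \<and>
          odd_winning_on G (positional \<sigma>) D \<and> closed_on G (positional \<sigma>) D \<and>
          attracting G (positional \<sigma>) (attr G k (verts G) {v}) {v})))"
proof -
  note G = assms(1) and nt = assms(3) and k = assms(6)
  let ?L = "{z \<in> verts G. prio G z < k}"
  have v: "v \<in> verts G" "\<rho> = lift G \<rho>\<^sub>0 v" using assms(4) by (auto simp: lift_at_def)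
  define A where "A = attr G k (verts G) {v}"
  have vA: "v \<in> A" unfolding A_def by (rule attr.base) simp
  have A: "A \<subseteq> prio_ge G k"
    unfolding A_def using v k by (intro attr_subset_prio_ge) (auto simp: prio_ge_def)
  obtain W0 W1 s0 s1 where W: "W0 \<union> W1 = prio_ge G k - A"
    and W0: "wins_region (edges G) (even_verts G) (prio G) True ?L W0 s0"
    and W1: "wins_region (edges G) (odd_verts G) (prio G) False A W1 s1"
    by (rule guarded_game_regions[OF G v(1) k A_def])
  define D where "D = A \<union> W1"
  have W0v: "W0 \<subseteq> prio_ge G k" "W0 \<subseteq> verts G" "v \<notin> W0"
    using W vA by (auto simp: prio_ge_def)
  from lifting_run_bound[OF G W0 W0v(1) assms(2) nt]
  have pm: "\<And>w. w \<in> verts G \<Longrightarrow> \<rho>\<^sub>0 w \<in> pm_set G"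
    and le: "\<And>w. w \<in> W0 \<union> ?L \<Longrightarrow> \<rho>\<^sub>0 w \<le> bound G k W0 s0 w" by blast+
  \<comment> \<open>The old value of \<open>v\<close> is not \<open>Top\<close>, so the new one
    comes from \<open>prog\<close> at some successor; if \<open>v\<close> belongs to even it is a
    minimum, and all successors yield \<open>Top\<close>.\<close>
  obtain x where x: "x \<in> succs G v" "prog G \<rho>\<^sub>0 v x = Top"
    and x_even: "v \<in> even_verts G \<Longrightarrow> \<forall>y\<in>succs G v. prog G \<rho>\<^sub>0 v y = Top"
    by (rule lift_cases[OF G v(1), of \<rho>\<^sub>0]) (use nt v assms(5) in auto)
  have xv: "x \<in> verts G" using x succs_subset[OF G] by blast
  \<comment> \<open>The measure of \<open>x\<close> is not yet \<open>Top\<close>, so only an odd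
    priority can produce \<open>Top\<close>.\<close>
  have "odd k" using prog_Top_odd[OF x(2) pm[OF xv]] nt xv k by blast
  \<comment> \<open>A successor with at least the measure of one that forces \<open>Top\<close>
    exceeds its bound, so it is neither in \<open>W0\<close> nor of priority below
    \<open>k\<close>.\<close>
  have D: "u \<in> D" if "w \<in> succs G v" "prog G \<rho>\<^sub>0 v w = Top" "\<rho>\<^sub>0 w \<le> \<rho>\<^sub>0 u" "u \<in> succs G v" for w u
  proof (rule ccontr)
    assume "u \<notin> D"
    then have "u \<in> W0 \<union> ?L"
      using W that(4) succs_subset[OF G, of v] by (auto simp: D_def prio_ge_def)
    from prog_Top_not_bounded[OF G v(1) k \<open>odd k\<close> W0v(3,2) that(2) order_trans[OF that(3) le[OF this]]]
    show False .
  qed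
  have Dk: "\<forall>w\<in>D. k \<le> prio G w" "D \<subseteq> verts G" "A \<subseteq> D"
    using A W by (auto simp: D_def prio_ge_def)
  have strategy: "\<exists>\<sigma>. odd_strategy G (positional \<sigma>) \<and> closed_on G (positional \<sigma>) D \<and>
      odd_winning_on G (positional \<sigma>) D \<and> (v \<in> odd_verts G \<longrightarrow> \<sigma> v = u) \<and>
      attracting G (positional \<sigma>) A {v}"
    if "v \<in> odd_verts G \<Longrightarrow> u \<in> succs G v \<inter> D" "v \<in> even_verts G \<Longrightarrow> succs G v \<subseteq> D" for u
    using odd_dominion_through_vertex[OF G v(1) k \<open>odd k\<close> A_def W1 _ _ that[unfolded D_def]] W
    unfolding D_def by (smt (verit) Diff_disjoint Diff_subset Int_commute Un_subset_iff disjoint_iff subsetD sup_ge2)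
  have dominion: "odd_dominion G D"
    if "odd_strategy G (positional \<sigma>)" "closed_on G (positional \<sigma>) D" "odd_winning_on G (positional \<sigma>) D" for \<sigma>
    using that Dk(2) unfolding odd_dominion_def by blast
  have disj: "even_verts G \<inter> odd_verts G = {}" using G by (simp add: parity_game_def)
  show ?thesis
    unfolding A_def[symmetric]
  proof (intro conjI impI ballI)
    fix \<mu> u
    assume v_odd: "v \<in> odd_verts G" and \<mu>: "\<mu> \<in> {\<rho>\<^sub>0, \<rho>}" and u: "u \<in> succs G v"
      and max: "\<forall>w\<in>succs G v. \<mu> w \<le> \<mu> u"
    have "u \<in> D"
    \<comment> \<open>The measures before and after the lift differ only at \<open>v\<close>, which
      lies in \<open>A\<close>. For any other \<open>u\<close>, maximality gives \<open>u\<close> at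
      least the measure \<open>\<rho>\<^sub>0 x\<close>.\<close>
    proof (cases "u = v")
      case True
      then show ?thesis using vA Dk(3) by blast
    next
      case False
      have "\<rho>\<^sub>0 w \<le> \<rho> w" for w
        using assms(4) by (metis le_funD less_imp_le lift_at_def)
      then have "\<rho>\<^sub>0 x \<le> \<mu> x" using \<mu> by auto
      also have "\<mu> x \<le> \<mu> u" using max x(1) by blast
      also have "\<mu> u = \<rho>\<^sub>0 u" using \<mu> lift_other[OF False] v(2) by auto
      finally show ?thesis by (rule D[OF x _ u])
    qed
    with u v_odd disj strategy[of u] obtain \<sigma> where "odd_strategy G (positional \<sigma>)"
      "closed_on G (positional \<sigma>) D" "odd_winning_on G (positional \<sigma>) D" "\<sigma> v = u"
      "attracting G (positional \<sigma>) A {v}" by blast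
    with Dk dominion show "\<exists>D. odd_dominion G D \<and> A \<subseteq> D \<and> (\<forall>w\<in>D. k \<le> prio G w) \<and>
      (\<exists>\<sigma>. odd_strategy G (positional \<sigma>) \<and> odd_winning_on G (positional \<sigma>) D \<and>
        closed_on G (positional \<sigma>) D \<and> \<sigma> v = u \<and> attracting G (positional \<sigma>) A {v})"
      by blast
  next
    assume v_even: "v \<in> even_verts G"
    then have "succs G v \<subseteq> D" using x_even D by blast
    \<comment> \<open>Here \<open>v\<close> is a dummy for the move at \<open>v\<close>, where odd
      has no choice to make.\<close>
    with v_even disj strategy[of v] obtain \<sigma> where "odd_strategy G (positional \<sigma>)"
      "closed_on G (positional \<sigma>) D" "odd_winning_on G (positional \<sigma>) D"
      "attracting G (positional \<sigma>) A {v}" by blast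
    with Dk dominion \<open>succs G v \<subseteq> D\<close>
    show "\<exists>D. odd_dominion G D \<and> A \<subseteq> D \<and> (\<forall>w\<in>D. k \<le> prio G w) \<and> succs G v \<subseteq> D \<and>
      (\<exists>\<sigma>. odd_strategy G (positional \<sigma>) \<and> odd_winning_on G (positional \<sigma>) D \<and>
        closed_on G (positional \<sigma>) D \<and> attracting G (positional \<sigma>) A {v})"
      by blast
  qed
qed

end
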